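(* For any fixed $1\le j\le n$, for every $f,g\in\mathcal F_{n,d}$ and every $\lambda\in(0,1)$, $$\mathbb V_j(\lambda f+(1-\lambda)g)\le \mathbb V_j(f)^{\lambda}\,\mathbb V_j(g)^{1-\lambda}\qquad\text{and}\qquad \widetilde{\mathbb V}_j(\lambda f+(1-\lambda)g)\le \widetilde{\mathbb V}_j(f)^{\lambda}\,\widetilde{\mathbb V}_j(g)^{1-\lambda}.$$
   Context: Fix natural numbers $n\ge2$ and $d\ge2$ with $d$ even. $\mathcal F_{n,d}$ is the set of positively $d$-homogeneous polynomials $f:\mathbb R^n\to\mathbb R$ ($f(\lambda x)=\lambda^df(x)$ for $\lambda>0$) with $f(x)>0$ for all $x\neq0$. $G(j,n)$ is the Grassmannian of $j$-dimensional linear subspaces of $\mathbb R^n$ with its rotation-invariant (Haar) probability measure $\nu_j$; $\kappa_m$ is the volume of the unit ball of $\mathbb R^m$. For $E\in G(j,n)$, $y\in E$: $\Pi_Ef(y):=\inf_{z\in E^\perp}f(y+z)$ and $\mathscr R_Ef:=f|_E$. Set $\beta_{j,n}=\binom nj\frac{\kappa_n}{\kappa_j\kappa_{n-j}}$ and $\sigma_{j,n}=\frac{\kappa_n}{\kappa_{n-j}}$. For $f\in\mathcal F_{n,d}$ and $1\le j\le n-1$, $$\mathbb V_j(f):=\frac{\beta_{j,n}}{\Gamma(1+j/d)}\int_{G(j,n)}\int_E e^{-\Pi_Ef(y)}\,dy\,d\nu_j(E),\qquad \widetilde{\mathbb V}_j(f):=\frac{\sigma_{j,n}}{\Gamma(1+j/d)}\int_{G(j,n)}\int_E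 e^{-\mathscr R_Ef(y)}\,dy\,d\nu_j(E),$$ and $\mathbb V_n(f)=\widetilde{\mathbb V}_n(f):=\frac1{\Gamma(1+n/d)}\int_{\mathbb R^n}e^{-f(x)}\,dx$. These quantities are finite on $\mathcal F_{n,d}$. *)

theory Defs
  imports "HOL-Analysis.Analysis" "HOL-Probability.Probability_Measure"
begin

text \<open>The ambient space is \<open>real ^ 'n\<close>, so the dimension \<open>n\<close> is \<open>CARD('n)\<close>.\<close>

definition pos_hom_poly :: "nat \<Rightarrow> (real ^ 'n \<Rightarrow> real) set" where
  "pos_hom_poly d =
    {f. real_polynomial_function f \<and>
        (\<forall>c>0. \<forall>x. f (c *\<^sub>R x) = c ^ d * f x) \<and>
        (\<forall>x. x \<noteq> 0 \<longrightarrow> f x > 0)}"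

definition grassmannian :: "nat \<Rightarrow> (real ^ 'n) set set" where
  "grassmannian j = {E. subspace E \<and> dim E = j}"

text \<open>On a subspace \<open>E\<close>, \<open>closest_point E\<close> is the orthogonal projection onto \<open>E\<close>.  The
  Grassmannian carries the topology that makes the injection of \<open>E\<close> to the matrix of this
  projection an embedding; the following is its Borel sigma-algebra.\<close>

definition grassmannian_borel :: "nat \<Rightarrow> (real ^ 'n) set measure" where
  "grassmannian_borel j =
    vimage_algebra (grassmannian j) (\<lambda>E. matrix (closest_point E)) borel"

text \<open>For \<open>n \<ge> 2\<close> and \<open>1 \<le> j \<le> n - 1\<close> the rotation group acts transitively on the
  Grassmannian, so exactly one measure satisfies the following predicate.\<close>

definition haar_grassmannian :: "nat \<Rightarrow> (real ^ 'n) set measure \<Rightarrow> bool" where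
  "haar_grassmannian j \<nu> \<longleftrightarrow>
    prob_space \<nu> \<and>
    sets \<nu> = sets (grassmannian_borel j) \<and>
    (\<forall>Q :: real ^ 'n ^ 'n. rotation_matrix Q \<longrightarrow> distr \<nu> \<nu> (\<lambda>E. (*v) Q ` E) = \<nu>)"

definition orthonormal_basis_of :: "(real ^ 'n) set \<Rightarrow> (real ^ 'n) set" where
  "orthonormal_basis_of E =
    (SOME B. pairwise orthogonal B \<and> (\<forall>b\<in>B. norm b = 1) \<and> span B = E)"

text \<open>Lebesgue measure of dimension \<open>dim E\<close> on a subspace \<open>E\<close>, viewed as a Borel measure on
  the ambient space concentrated on \<open>E\<close>.  It is built exactly as the library builds
  \<open>lborel\<close>, with an orthonormal basis of \<open>E\<close> in place of the standard basis; it does not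
  depend on the chosen basis.\<close>

definition lborel_subspace :: "(real ^ 'n) set \<Rightarrow> (real ^ 'n) measure" where
  "lborel_subspace E =
    distr (\<Pi>\<^sub>M b\<in>orthonormal_basis_of E. lborel) borel
      (\<lambda>c. \<Sum>b\<in>orthonormal_basis_of E. c b *\<^sub>R b)"

definition proj_fun :: "(real ^ 'n) set \<Rightarrow> (real ^ 'n \<Rightarrow> real) \<Rightarrow> real ^ 'n \<Rightarrow> real" where
  "proj_fun E f = (\<lambda>y\<in>E. INF z\<in>E\<^sup>\<bottom>. f (y + z))"

definition restr_fun :: "(real ^ 'n) set \<Rightarrow> (real ^ 'n \<Rightarrow> real) \<Rightarrow> real ^ 'n \<Rightarrow> real" where
  "restr_fun E f = restrict f E"

text \<open>\<open>unit_ball_vol\<close> is the volume of the unit ball of the given dimension.\<close>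

definition beta_coeff :: "nat \<Rightarrow> nat \<Rightarrow> real" where
  "beta_coeff j n =
    real (n choose j) *
      (unit_ball_vol (real n) / (unit_ball_vol (real j) * unit_ball_vol (real (n - j))))"

definition sigma_coeff :: "nat \<Rightarrow> nat \<Rightarrow> real" where
  "sigma_coeff j n = unit_ball_vol (real n) / unit_ball_vol (real (n - j))"

definition V_top :: "nat \<Rightarrow> (real ^ 'n \<Rightarrow> real) \<Rightarrow> real" where
  "V_top d f = 1 / Gamma (1 + real CARD('n) / real d) * (LINT x|lborel. exp (- f x))"

text \<open>The intended argument \<open>\<nu>\<close> below is the invariant probability measure on the
  Grassmannian of \<open>j\<close>-dimensional subspaces; it is not used when \<open>j = n\<close>.\<close>

definition V_proj ::
    "(real ^ 'n) set measure \<Rightarrow> nat \<Rightarrow> nat \<Rightarrow> (real ^ 'n \<Rightarrow> real) \<Rightarrow> real" where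
  "V_proj \<nu> d j f =
    (if j = CARD('n) then V_top d f
     else beta_coeff j CARD('n) / Gamma (1 + real j / real d) *
       (LINT E|\<nu>. (LINT y:E|lborel_subspace E. exp (- proj_fun E f y))))"

definition V_restr ::
    "(real ^ 'n) set measure \<Rightarrow> nat \<Rightarrow> nat \<Rightarrow> (real ^ 'n \<Rightarrow> real) \<Rightarrow> real" where
  "V_restr \<nu> d j f =
    (if j = CARD('n) then V_top d f
     else sigma_coeff j CARD('n) / Gamma (1 + real j / real d) *
       (LINT E|\<nu>. (LINT y:E|lborel_subspace E. exp (- restr_fun E f y))))"

end

theory Submission
  imports Defs "HOL-Probability.Distributions"
begin

text \<open>Both functionals are iterated integrals of \<open>exp (- k)\<close>, where the exponent \<open>k\<close> depends on the
  polynomial in a superadditive (projection) or linear (restriction) way, so the inequality follows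
  by applying Hoelder's inequality first on each subspace and then on the Grassmannian.  The outer
  application needs the inner integral to be bounded and measurable in the subspace \<open>E\<close>.  This
  comes from Fubini: multiplying it by the Gaussian integral of \<open>E\<^sup>\<bottom>\<close>, a constant, turns it into an
  integral over the whole space of an integrand that is jointly Borel in the point and the matrix of
  the projection onto \<open>E\<close>.\<close>

section \<open>Gaussian integrals\<close>

lemma gaussian_nn_integral:
  fixes m :: real
  assumes "0 < m"
  shows "(\<integral>\<^sup>+t. ennreal (exp (- (m * t\<^sup>2))) \<partial>lborel) = ennreal (sqrt (pi / m))"
proof -
  \<comment> \<open>With variance 1/(2m) the normal density has exponent -m t^2, so only its
    normalising factor remains.\<close>
  define s where "s = sqrt (1 / (2 * m))"
  have s: "s > 0" "s\<^sup>2 = 1 / (2 * m)"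
    using assms by (auto simp: s_def)
  have eq: "exp (- (m * t\<^sup>2)) = sqrt (pi / m) * normal_density 0 s t" for t
    using assms by (simp add: normal_density_def s field_simps)
  have "(\<integral>\<^sup>+t. ennreal (exp (- (m * t\<^sup>2))) \<partial>lborel) = ennreal (\<integral>t. sqrt (pi / m) * normal_density 0 s t \<partial>lborel)"
    unfolding eq using s assms
    by (intro nn_integral_eq_integral integrable_mult_right integrable_normal_density) auto
  then show ?thesis
    using s by (simp add: integral_normal_density)
qed

lemma gaussian_nn_integral_euclidean:
  fixes m :: real
  assumes "0 < m"
  shows "(\<integral>\<^sup>+x. ennreal (exp (- (m * (norm (x::'a::euclidean_space))\<^sup>2))) \<partial>lborel) = ennreal (sqrt (pi / m)) ^ DIM('a)"
proof -
  have "ennreal (exp (- (m * (norm x)\<^sup>2))) = (\<Prod>b\<in>Basis. ennreal (exp (- (m * (x \<bullet> b)\<^sup>2))))" for x :: 'a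
    by (simp add: norm_eq_sqrt_inner euclidean_inner[of x x] sum_nonneg sum_distrib_left
        prod_ennreal exp_sum power2_eq_square flip: sum_negf)
  then show ?thesis
    using nn_integral_lborel_prod[where 'a='a and f="\<lambda>_ t. ennreal (exp (- (m * t\<^sup>2)))"]
    by (simp add: gaussian_nn_integral assms)
qed

section \<open>Lebesgue measure in orthonormal coordinates\<close>

text \<open>A product measure is determined by boxes, and on a box each factor is translation
  invariant. This supplies the coordinate side of the uniqueness argument below.\<close>

lemma distr_PiM_lborel_translation:
  fixes t :: "'i \<Rightarrow> real"
  assumes "finite I"
  shows "distr (\<Pi>\<^sub>M i\<in>I. lborel) (\<Pi>\<^sub>M i\<in>I. lborel) (\<lambda>c. \<lambda>i\<in>I. t i + c i) = (\<Pi>\<^sub>M i\<in>I. lborel)"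
proof -
  interpret product_sigma_finite "\<lambda>_::'i. lborel :: real measure"
    by standard
  have [measurable]: "(\<lambda>c. \<lambda>i\<in>I. t i + c i) \<in> (\<Pi>\<^sub>M i\<in>I. lborel) \<rightarrow>\<^sub>M (\<Pi>\<^sub>M i\<in>I. lborel)"
    by measurable
  show ?thesis
  proof (rule PiM_eqI)
    fix A :: "'i \<Rightarrow> real set"
    assume A: "\<And>i. i \<in> I \<Longrightarrow> A i \<in> sets lborel"
    have "(\<lambda>c. \<lambda>i\<in>I. t i + c i) -` Pi\<^sub>E I A \<inter> space (\<Pi>\<^sub>M i\<in>I. lborel) = Pi\<^sub>E I (\<lambda>i. (+) (t i) -` A i)"
      by (auto simp: space_PiM PiE_iff)
    moreover have "(+) (t i) -` A i \<in> sets lborel"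
      and "emeasure lborel ((+) (t i) -` A i) = emeasure lborel (A i)" if "i \<in> I" for i
    proof -
      have "(+) (t i) \<in> borel \<rightarrow>\<^sub>M (borel :: real measure)"
        by measurable
      from measurable_sets[OF this, of "A i"] A[OF that] show "(+) (t i) -` A i \<in> sets lborel"
        by simp
      have "emeasure lborel (A i) = emeasure (distr lborel borel ((+) (t i))) (A i)"
        by (simp add: lborel_distr_plus)
      then show "emeasure lborel ((+) (t i) -` A i) = emeasure lborel (A i)"
        using A[OF that] by (simp add: emeasure_distr)
    qed
    ultimately show "emeasure (distr (\<Pi>\<^sub>M i\<in>I. lborel) (\<Pi>\<^sub>M i\<in>I. lborel) (\<lambda>c. \<lambda>i\<in>I. t i + c i)) (Pi\<^sub>E I A)
      = (\<Prod>i\<in>I. emeasure lborel (A i))"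
      using A assms by (subst emeasure_distr) (auto simp: emeasure_PiM intro!: sets_PiM_I_finite)
  qed (use assms in auto)
qed

lemma norm_sum_orthonormal:
  fixes B :: "'a::euclidean_space set"
  assumes "pairwise orthogonal B" "\<And>b. b \<in> B \<Longrightarrow> norm b = 1" "finite B"
  shows "(norm (\<Sum>b\<in>B. c b *\<^sub>R b))\<^sup>2 = (\<Sum>b\<in>B. (c b)\<^sup>2)"
proof -
  have "(norm (\<Sum>b\<in>B. c b *\<^sub>R b))\<^sup>2 = (\<Sum>b\<in>B. (norm (c b *\<^sub>R b))\<^sup>2)"
    using assms by (intro norm_sum_Pythagorean) (auto simp: pairwise_def orthogonal_clauses)
  then show ?thesis
    using assms by simp
qed

lemma gaussian_nn_integral_orthonormal:
  fixes B :: "'a::euclidean_space set"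
  assumes "pairwise orthogonal B" "\<And>b. b \<in> B \<Longrightarrow> norm b = 1" "finite B"
  shows "(\<integral>\<^sup>+c. ennreal (exp (- (norm (\<Sum>b\<in>B. c b *\<^sub>R b))\<^sup>2)) \<partial>(\<Pi>\<^sub>M b\<in>B. lborel)) = ennreal (sqrt pi) ^ card B"
proof -
  interpret product_sigma_finite "\<lambda>_::'a. lborel :: real measure"
    by standard
  have "ennreal (exp (- (norm (\<Sum>b\<in>B. c b *\<^sub>R b))\<^sup>2)) = (\<Prod>b\<in>B. ennreal (exp (- (c b)\<^sup>2)))" for c
    using assms by (simp add: norm_sum_orthonormal prod_ennreal exp_sum flip: sum_negf)
  then show ?thesis
    using assms gaussian_nn_integral[of 1] product_nn_integral_prod[of B "\<lambda>_ t. ennreal (exp (- t\<^sup>2))"]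
    by simp
qed

text \<open>Uniqueness of translation-invariant measures, in the form of a Fubini argument: both sides are
  integrated against a Gaussian, whose integral is the same for the two measures.\<close>

lemma nn_integral_lborel_orthonormal_basis:
  fixes B :: "'a::euclidean_space set" and g :: "'a \<Rightarrow> ennreal"
  assumes B: "pairwise orthogonal B" "\<And>b. b \<in> B \<Longrightarrow> norm b = 1" "finite B" "span B = UNIV"
    and g [measurable]: "g \<in> borel_measurable borel"
  shows "(\<integral>\<^sup>+c. g (\<Sum>b\<in>B. c b *\<^sub>R b) \<partial>(\<Pi>\<^sub>M b\<in>B. lborel)) = (\<integral>\<^sup>+x. g x \<partial>lborel)"
proof -
  interpret P: finite_product_sigma_finite "\<lambda>_::'a. lborel :: real measure" B
    by standard fact
  interpret pair_sigma_finite "\<Pi>\<^sub>M b\<in>B. (lborel :: real measure)" "lborel :: 'a measure"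
    by standard
  define Q where "Q = (\<Pi>\<^sub>M b\<in>B. (lborel :: real measure))"
  define S where "S c = (\<Sum>b\<in>B. c b *\<^sub>R b)" for c
  define w where "w x = ennreal (exp (- (norm x)\<^sup>2))" for x :: 'a
  have [measurable]: "S \<in> Q \<rightarrow>\<^sub>M borel" "w \<in> borel_measurable borel"
    unfolding S_def Q_def w_def by measurable
  have card: "card B = DIM('a)"
    using B dim_span_eq_card_independent pairwise_orthogonal_independent
    by (metis dim_UNIV norm_zero zero_neq_one)
  have wL: "(\<integral>\<^sup>+x. w x \<partial>lborel) = ennreal (sqrt pi) ^ DIM('a)"
    using gaussian_nn_integral_euclidean[of 1, where 'a='a] by (simp add: w_def)
  have wQ: "(\<integral>\<^sup>+c. w (S c) \<partial>Q) = ennreal (sqrt pi) ^ DIM('a)"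
    using gaussian_nn_integral_orthonormal[OF B(1-3)] by (simp add: w_def S_def Q_def card)
  have trL: "(\<integral>\<^sup>+y. h (x + y) \<partial>lborel) = (\<integral>\<^sup>+y. h y \<partial>lborel)"
    if "h \<in> borel_measurable borel" for h :: "'a \<Rightarrow> ennreal" and x
    using that by (subst (2) lborel_distr_plus[of x, symmetric]) (simp add: nn_integral_distr)
  have trQ: "(\<integral>\<^sup>+c. h (y + S c) \<partial>Q) = (\<integral>\<^sup>+c. h (S c) \<partial>Q)"
    if [measurable]: "h \<in> borel_measurable borel" for h :: "'a \<Rightarrow> ennreal" and y
  proof -
    \<comment> \<open>Translation by \<open>y\<close> in the ambient space shifts the coordinate at
      \<open>b\<close> by \<open>y \<bullet> b\<close>.\<close>
    have "(\<Sum>b\<in>B. (y \<bullet> b) *\<^sub>R b) = y"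
      using B by (intro orthonormal_basis_expand) auto
    then have S: "S (\<lambda>b\<in>B. y \<bullet> b + c b) = y + S c" for c
      by (simp add: S_def scaleR_add_left sum.distrib)
    have [measurable]: "(\<lambda>c. \<lambda>b\<in>B. y \<bullet> b + c b) \<in> Q \<rightarrow>\<^sub>M Q"
      unfolding Q_def by measurable
    have "(\<integral>\<^sup>+c. h (S c) \<partial>Q) = (\<integral>\<^sup>+c. h (S c) \<partial>(distr Q Q (\<lambda>c. \<lambda>b\<in>B. y \<bullet> b + c b)))"
      using distr_PiM_lborel_translation[of B "\<lambda>b. y \<bullet> b"] B by (simp add: Q_def)
    also have "\<dots> = (\<integral>\<^sup>+c. h (y + S c) \<partial>Q)"
      by (subst nn_integral_distr) (auto simp: S)
    finally show ?thesis ..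
  qed
  have "(\<integral>\<^sup>+c. g (S c) \<partial>Q) * (\<integral>\<^sup>+y. w y \<partial>lborel) = (\<integral>\<^sup>+c. (\<integral>\<^sup>+y. g (S c) * w y \<partial>lborel) \<partial>Q)"
    by (simp add: nn_integral_cmult nn_integral_multc)
  also have "\<dots> = (\<integral>\<^sup>+c. (\<integral>\<^sup>+y. g (S c) * w (y - S c) \<partial>lborel) \<partial>Q)"
  proof (rule nn_integral_cong)
    show "(\<integral>\<^sup>+y. g (S c) * w y \<partial>lborel) = (\<integral>\<^sup>+y. g (S c) * w (y - S c) \<partial>lborel)" for c
      using trL[of "\<lambda>y. g (S c) * w y" "- S c"] by simp
  qed
  also have "\<dots> = (\<integral>\<^sup>+y. (\<integral>\<^sup>+c. g (S c) * w (y - S c) \<partial>Q) \<partial>lborel)"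
    unfolding Q_def by (rule Fubini'[symmetric]) (simp add: Q_def[symmetric])
  \<comment> \<open>The shift by \<open>y\<close> turns \<open>w (y - S c)\<close> into
    \<open>w (- S c)\<close>, and the Gaussian is even.\<close>
  also have "\<dots> = (\<integral>\<^sup>+y. (\<integral>\<^sup>+c. g (y + S c) * w (S c) \<partial>Q) \<partial>lborel)"
  proof (rule nn_integral_cong)
    show "(\<integral>\<^sup>+c. g (S c) * w (y - S c) \<partial>Q) = (\<integral>\<^sup>+c. g (y + S c) * w (S c) \<partial>Q)" for y
      using trQ[of "\<lambda>x. g x * w (y - x)" y] by (simp add: w_def)
  qed
  also have "\<dots> = (\<integral>\<^sup>+c. (\<integral>\<^sup>+y. g (y + S c) * w (S c) \<partial>lborel) \<partial>Q)"
    unfolding Q_def by (rule Fubini') (simp add: Q_def[symmetric])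
  also have "\<dots> = (\<integral>\<^sup>+c. (\<integral>\<^sup>+y. g y \<partial>lborel) * w (S c) \<partial>Q)"
    by (simp add: nn_integral_multc trL[of g] add.commute[of _ "S _"])
  also have "\<dots> = (\<integral>\<^sup>+y. g y \<partial>lborel) * (\<integral>\<^sup>+c. w (S c) \<partial>Q)"
    by (simp add: nn_integral_cmult)
  finally have "(\<integral>\<^sup>+c. g (S c) \<partial>Q) * ennreal (sqrt pi ^ DIM('a)) = (\<integral>\<^sup>+y. g y \<partial>lborel) * ennreal (sqrt pi ^ DIM('a))"
    by (simp only: wL wQ ennreal_power[symmetric] real_sqrt_ge_zero pi_ge_zero)
  \<comment> \<open>The Gaussian constant is positive and finite, so it cancels in
    \<open>ennreal\<close>.\<close>
  then have "(\<integral>\<^sup>+c. g (S c) \<partial>Q) = (\<integral>\<^sup>+y. g y \<partial>lborel)"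
    by (simp add: ennreal_mult_cancel_left mult.commute[of _ "ennreal _"])
  then show ?thesis
    by (simp add: S_def Q_def)
qed

section \<open>Orthonormal bases and orthogonal projections\<close>

lemma orthonormal_basis_of:
  assumes "subspace E"
  shows "pairwise orthogonal (orthonormal_basis_of E)"
    and "\<And>b. b \<in> orthonormal_basis_of E \<Longrightarrow> norm b = 1"
    and "span (orthonormal_basis_of E) = E"
    and "finite (orthonormal_basis_of E)"
    and "card (orthonormal_basis_of E) = dim E"
proof -
  let ?B = "orthonormal_basis_of E"
  have "\<exists>B. pairwise orthogonal B \<and> (\<forall>b\<in>B. norm b = 1) \<and> span B = E"
    using orthonormal_basis_subspace[OF assms] by metis
  from someI_ex[OF this]
  have *: "pairwise orthogonal ?B \<and> (\<forall>b\<in>?B. norm b = 1) \<and> span ?B = E"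
    by (simp add: orthonormal_basis_of_def)
  then show "pairwise orthogonal ?B" "\<And>b. b \<in> ?B \<Longrightarrow> norm b = 1" "span ?B = E"
    by auto
  have "independent ?B"
    using * by (intro pairwise_orthogonal_independent) auto
  then show "finite ?B" "card ?B = dim E"
    using * dim_span_eq_card_independent[of ?B] by (auto simp: independent_imp_finite)
qed

text \<open>For \<open>z\<close> in \<open>E\<close>, \<open>x - z\<close> is the sum of the
  orthogonal vectors \<open>x - y\<close> and \<open>y - z\<close>, so Pythagoras makes
  \<open>y\<close> nearest. Linearity and concrete values of the projection then follow by
  exhibiting such a decomposition.\<close>

lemma closest_point_subspace_eqI:
  fixes E :: "'a::euclidean_space set"
  assumes "subspace E" "y \<in> E" "x - y \<in> E\<^sup>\<bottom>"
  shows "closest_point E x = y"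
proof (rule closest_point_unique[symmetric])
  show "\<forall>z\<in>E. dist x y \<le> dist x z"
  proof
    fix z assume "z \<in> E"
    then have "y - z \<in> E"
      using assms by (simp add: subspace_diff)
    then have "orthogonal (x - y) (y - z)"
      using assms(3) by (auto simp: orthogonal_comp_def orthogonal_commute)
    from norm_add_Pythagorean[OF this] have "(norm (x - y))\<^sup>2 \<le> (norm (x - z))\<^sup>2"
      by simp
    then show "dist x y \<le> dist x z"
      by (simp add: dist_norm)
  qed
qed (use assms in \<open>auto simp: subspace_imp_convex closed_subspace\<close>)

lemma closest_point_subspace:
  fixes E :: "'a::euclidean_space set"
  assumes "subspace E"
  shows "closest_point E x \<in> E" "x - closest_point E x \<in> E\<^sup>\<bottom>"
proof -
  have "x \<in> E + E\<^sup>\<bottom>"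
    using subspace_sum_orthogonal_comp[OF assms] by simp
  then obtain y z where "y \<in> E" "z \<in> E\<^sup>\<bottom>" "x = y + z"
    by (rule set_plus_elim)
  moreover from this have "closest_point E x = y"
    by (intro closest_point_subspace_eqI assms) auto
  ultimately show "closest_point E x \<in> E" "x - closest_point E x \<in> E\<^sup>\<bottom>"
    by auto
qed

lemma norm_closest_point_subspace:
  fixes E :: "'a::euclidean_space set"
  assumes "subspace E"
  shows "(norm x)\<^sup>2 = (norm (closest_point E x))\<^sup>2 + (norm (x - closest_point E x))\<^sup>2"
  using closest_point_subspace[OF assms, of x]
  by (subst norm_add_Pythagorean[symmetric]) (auto simp: orthogonal_comp_def)

lemma linear_closest_point_subspace:
  fixes E :: "'a::euclidean_space set"
  assumes E: "subspace E"
  shows "linear (closest_point E)"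
proof
  fix x y :: 'a and r :: real
  note cp = closest_point_subspace[OF E]
  have "(x - closest_point E x) + (y - closest_point E y) \<in> E\<^sup>\<bottom>"
    by (intro subspace_add subspace_orthogonal_comp cp)
  then show "closest_point E (x + y) = closest_point E x + closest_point E y"
    by (intro closest_point_subspace_eqI E subspace_add cp) (simp add: algebra_simps)
  have "r *\<^sub>R (x - closest_point E x) \<in> E\<^sup>\<bottom>"
    by (intro subspace_scale subspace_orthogonal_comp cp)
  then show "closest_point E (r *\<^sub>R x) = r *\<^sub>R closest_point E x"
    by (intro closest_point_subspace_eqI E subspace_scale cp) (simp add: algebra_simps)
qed

lemma matrix_closest_point:
  fixes E :: "(real ^ 'n) set"
  assumes "subspace E"
  shows "matrix (closest_point E) *v x = closest_point E x"
  using linear_closest_point_subspace[OF assms] by (simp add: matrix_works)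

text \<open>Together the two bases form an orthonormal basis of the whole space; being disjoint,
  they let the coordinate measure factor along \<open>E\<close> and its complement.\<close>

lemma orthonormal_bases_of_complements:
  fixes E :: "(real ^ 'n) set"
  assumes E: "subspace E"
  defines "B \<equiv> orthonormal_basis_of E" and "C \<equiv> orthonormal_basis_of (E\<^sup>\<bottom>)"
  shows "B \<inter> C = {}" "pairwise orthogonal (B \<union> C)" "span (B \<union> C) = UNIV" "card C = CARD('n) - dim E"
proof -
  note EC = subspace_orthogonal_comp[of E]
  note b = orthonormal_basis_of[OF E, folded B_def] and c = orthonormal_basis_of[OF EC, folded C_def]
  have sub: "B \<subseteq> E" "C \<subseteq> E\<^sup>\<bottom>"
    using b c span_superset by blast+
  show disj: "B \<inter> C = {}"
  proof (rule ccontr)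
    assume "B \<inter> C \<noteq> {}"
    then obtain x where "x \<in> B" "x \<in> E \<inter> E\<^sup>\<bottom>"
      using sub by auto
    then show False
      using b(2)[of x] by (simp add: orthogonal_Int_0 E)
  qed
  show ortho: "pairwise orthogonal (B \<union> C)"
    unfolding pairwise_def
  proof (intro ballI impI)
    fix x y assume xy: "x \<in> B \<union> C" "y \<in> B \<union> C" "x \<noteq> y"
    have cross: "orthogonal u v" if "u \<in> B" "v \<in> C" for u v
      using that sub by (auto simp: orthogonal_comp_def)
    show "orthogonal x y"
      using xy b(1) c(1) cross[of x y] cross[of y x] orthogonal_commute[of x y]
      by (auto simp: pairwise_def)
  qed
  show span: "span (B \<union> C) = UNIV"
  proof -
    have "x \<in> span (B \<union> C)" for x
    proof -
      have "closest_point E x \<in> span (B \<union> C)" "x - closest_point E x \<in> span (B \<union> C)"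
        using closest_point_subspace[OF E, of x] b(3) c(3) span_mono[of B "B \<union> C"] span_mono[of C "B \<union> C"]
        by auto
      from span_add[OF this] show ?thesis by simp
    qed
    then show ?thesis by auto
  qed
  have "independent (B \<union> C)"
    using b(2) c(2) by (intro pairwise_orthogonal_independent ortho) force
  then have "card (B \<union> C) = CARD('n)"
    using dim_span_eq_card_independent[of "B \<union> C"] span by simp
  then show "card C = CARD('n) - dim E"
    using b c disj by (simp add: card_Un_disjoint)
qed

section \<open>Fubini along a subspace and its complement\<close>

lemma measurable_orthonormal_sum:
  "(\<lambda>c. \<Sum>b\<in>B. c b *\<^sub>R b) \<in> (\<Pi>\<^sub>M b\<in>B. lborel) \<rightarrow>\<^sub>M (borel :: ('a::euclidean_space) measure)"
  by measurable

text \<open>In coordinates from both bases the projection keeps exactly the part along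
  \<open>E\<close>, so the integrand factors and the complementary factor is a Gaussian integral.
  The varying measure \<open>lborel_subspace E\<close> is thereby traded for the fixed
  \<open>lborel\<close>, with \<open>E\<close> only in the integrand.\<close>

lemma nn_integral_lborel_subspace:
  fixes E :: "(real ^ 'n) set" and \<phi> :: "real ^ 'n \<Rightarrow> ennreal"
  assumes E: "subspace E" and [measurable]: "\<phi> \<in> borel_measurable borel"
  shows "(\<integral>\<^sup>+x. \<phi> (closest_point E x) * ennreal (exp (- (norm (x - closest_point E x))\<^sup>2)) \<partial>lborel)
    = (\<integral>\<^sup>+y. \<phi> y \<partial>lborel_subspace E) * ennreal (sqrt pi) ^ (CARD('n) - dim E)"
proof -
  interpret product_sigma_finite "\<lambda>_::real^'n. lborel :: real measure"
    by standard
  define B where "B = orthonormal_basis_of E"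
  define C where "C = orthonormal_basis_of (E\<^sup>\<bottom>)"
  note EC = subspace_orthogonal_comp[of E]
  note b = orthonormal_basis_of[OF E, folded B_def] and c = orthonormal_basis_of[OF EC, folded C_def]
  note bc = orthonormal_bases_of_complements[OF E, folded B_def C_def]
  define S where "S X c = (\<Sum>b\<in>X. c b *\<^sub>R b)" for X and c :: "real^'n \<Rightarrow> real"
  have [measurable]: "S X \<in> (\<Pi>\<^sub>M b\<in>X. lborel) \<rightarrow>\<^sub>M borel" for X
    unfolding S_def by (rule measurable_orthonormal_sum)
  have [measurable]: "closest_point E \<in> borel \<rightarrow>\<^sub>M borel"
    using linear_closest_point_subspace[OF E]
    by (intro borel_measurable_continuous_onI linear_continuous_on) (simp add: linear_conv_bounded_linear)
  let ?g = "\<lambda>x. \<phi> (closest_point E x) * ennreal (exp (- (norm (x - closest_point E x))\<^sup>2))"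
  have split: "S (B \<union> C) (merge B C (u, v)) = S B u + S C v" for u v
    using b c bc(1) by (auto simp: S_def sum.union_disjoint merge_def intro!: arg_cong2[of _ _ _ _ "(+)"] sum.cong)
  have proj: "closest_point E (S B u + S C v) = S B u" for u v
  proof (rule closest_point_subspace_eqI[OF E])
    have "S B u \<in> span B" "S C v \<in> span C"
      unfolding S_def by (intro span_sum span_scale span_base; assumption)+
    then show "S B u \<in> E" "S B u + S C v - S B u \<in> E\<^sup>\<bottom>"
      using b c by auto
  qed
  have "(\<integral>\<^sup>+x. ?g x \<partial>lborel) = (\<integral>\<^sup>+z. ?g (S (B \<union> C) z) \<partial>(\<Pi>\<^sub>M b\<in>B \<union> C. lborel))"
    unfolding S_def using b c bc
    by (intro nn_integral_lborel_orthonormal_basis[symmetric]) auto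
  also have "\<dots> = (\<integral>\<^sup>+u. (\<integral>\<^sup>+v. ?g (S (B \<union> C) (merge B C (u, v))) \<partial>(\<Pi>\<^sub>M b\<in>C. lborel)) \<partial>(\<Pi>\<^sub>M b\<in>B. lborel))"
    using b c bc by (intro product_nn_integral_fold) auto
  also have "\<dots> = (\<integral>\<^sup>+u. (\<integral>\<^sup>+v. \<phi> (S B u) * ennreal (exp (- (norm (S C v))\<^sup>2)) \<partial>(\<Pi>\<^sub>M b\<in>C. lborel)) \<partial>(\<Pi>\<^sub>M b\<in>B. lborel))"
    unfolding split proj by simp
  also have "\<dots> = (\<integral>\<^sup>+u. \<phi> (S B u) \<partial>(\<Pi>\<^sub>M b\<in>B. lborel)) * (\<integral>\<^sup>+v. ennreal (exp (- (norm (S C v))\<^sup>2)) \<partial>(\<Pi>\<^sub>M b\<in>C. lborel))"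
    by (simp add: nn_integral_cmult nn_integral_multc)
  also have "(\<integral>\<^sup>+v. ennreal (exp (- (norm (S C v))\<^sup>2)) \<partial>(\<Pi>\<^sub>M b\<in>C. lborel)) = ennreal (sqrt pi) ^ card C"
    unfolding S_def using c by (intro gaussian_nn_integral_orthonormal) auto
  also have "(\<integral>\<^sup>+u. \<phi> (S B u) \<partial>(\<Pi>\<^sub>M b\<in>B. lborel)) = (\<integral>\<^sup>+y. \<phi> y \<partial>lborel_subspace E)"
    unfolding lborel_subspace_def B_def[symmetric] S_def by (rule nn_integral_distr[symmetric]) auto
  finally show ?thesis
    by (simp add: bc)
qed

section \<open>Hoelder's inequality\<close>

text \<open>Young's inequality is applied pointwise to \<open>u\<close> and \<open>v\<close> divided
  by their integrals, and then integrated.\<close>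

lemma holder_integral_le:
  fixes u v w :: "'a \<Rightarrow> real" and l :: real
  assumes u: "integrable M u" "\<And>x. x \<in> space M \<Longrightarrow> 0 \<le> u x"
    and v: "integrable M v" "\<And>x. x \<in> space M \<Longrightarrow> 0 \<le> v x"
    and w: "\<And>x. x \<in> space M \<Longrightarrow> w x \<le> u x powr l * v x powr (1 - l)"
    and l: "0 < l" "l < 1"
  shows "integral\<^sup>L M w \<le> integral\<^sup>L M u powr l * integral\<^sup>L M v powr (1 - l)"
proof (cases "integrable M w")
  \<comment> \<open>A non-integrable \<open>w\<close> has Bochner integral 0, while the right-hand
    side is nonnegative. Later uses thus need no measurability of the convex combination.\<close>
  case False
  then show ?thesis
    by (simp add: not_integrable_integral_eq)
next
  case True
  define U where "U = integral\<^sup>L M u"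
  define V where "V = integral\<^sup>L M v"
  have UV: "0 \<le> U" "0 \<le> V"
    using u v by (auto simp: U_def V_def intro!: Bochner_Integration.integral_nonneg)
  consider "U = 0" | "V = 0" | "0 < U" "0 < V"
    using UV by linarith
  then have "integral\<^sup>L M w \<le> U powr l * V powr (1 - l)"
  proof cases
    \<comment> \<open>Normalising is impossible here, but \<open>u\<close> vanishes almost
      everywhere and \<open>0 powr l = 0\<close> forces \<open>w\<close> to be nonpositive
      there.\<close>
    case 1
    then have "AE x in M. u x = 0"
      using u unfolding U_def by (subst (asm) integral_nonneg_eq_0_iff_AE) auto
    then have "AE x in M. w x \<le> 0"
      by (rule AE_mp) (use w in \<open>auto intro!: AE_I2 dest!: w\<close>)
    then have "integral\<^sup>L M w \<le> integral\<^sup>L M (\<lambda>_. 0)"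
      by (intro integral_mono_AE True) auto
    then show ?thesis
      using 1 by simp
  next
    case 2
    then have "AE x in M. v x = 0"
      using v unfolding V_def by (subst (asm) integral_nonneg_eq_0_iff_AE) auto
    then have "AE x in M. w x \<le> 0"
      by (rule AE_mp) (use w in \<open>auto intro!: AE_I2 dest!: w\<close>)
    then have "integral\<^sup>L M w \<le> integral\<^sup>L M (\<lambda>_. 0)"
      by (intro integral_mono_AE True) auto
    then show ?thesis
      using 2 by simp
  next
    case 3
    define K where "K = U powr l * V powr (1 - l)"
    have K: "K > 0"
      using 3 by (simp add: K_def)
    have "w x \<le> K * (l * (u x / U) + (1 - l) * (v x / V))" if x: "x \<in> space M" for x
    proof -
      have "(u x / U) powr l * (v x / V) powr (1 - l) \<le> l * (u x / U) + (1 - l) * (v x / V)"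
      \<comment> \<open>Young's inequality is used for positive arguments; a zero argument makes the
        left side 0.\<close>
      proof (cases "u x = 0 \<or> v x = 0")
        case True
        have "0 \<le> l * (u x / U)" "0 \<le> (1 - l) * (v x / V)"
          using l 3 u(2)[OF x] v(2)[OF x] by auto
        moreover have "(u x / U) powr l * (v x / V) powr (1 - l) = 0"
          using True by auto
        ultimately show ?thesis
          by linarith
      next
        case False
        then have "u x / U > 0" "v x / V > 0"
          using 3 u(2)[OF x] v(2)[OF x] by (auto simp: less_le)
        then show ?thesis
          using l by (intro Youngs_inequality_0) auto
      qed
      moreover have "K * ((u x / U) powr l * (v x / V) powr (1 - l)) = u x powr l * v x powr (1 - l)"
        using 3 u(2)[OF x] v(2)[OF x] by (simp add: K_def powr_divide)
      ultimately show ?thesis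
        using w[OF x] K by (smt (verit) mult_left_mono)
    qed
    then have "integral\<^sup>L M w \<le> integral\<^sup>L M (\<lambda>x. K * (l * (u x / U) + (1 - l) * (v x / V)))"
      using u v True by (intro integral_mono) auto
    also have "\<dots> = K * (l * (U / U) + (1 - l) * (V / V))"
      using u v by (simp add: U_def V_def)
    also have "\<dots> = K"
      using 3 by simp
    finally show ?thesis
      by (simp add: K_def)
  qed
  then show ?thesis
    by (simp add: U_def V_def)
qed

section \<open>Integrability over the Grassmannian\<close>

lemma AE_lborel_subspace:
  assumes "subspace E"
  shows "AE y in lborel_subspace E. y \<in> E"
proof -
  have "(\<Sum>b\<in>orthonormal_basis_of E. c b *\<^sub>R b) \<in> span (orthonormal_basis_of E)" for c
    by (intro span_sum span_scale span_base)
  then have "AE c in \<Pi>\<^sub>M b\<in>orthonormal_basis_of E. lborel. (\<Sum>b\<in>orthonormal_basis_of E. c b *\<^sub>R b) \<in> E"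
    using orthonormal_basis_of(3)[OF assms] by simp
  then show ?thesis
    unfolding lborel_subspace_def using closed_subspace[OF assms]
    by (subst AE_distr_iff) (auto intro: measurable_orthonormal_sum)
qed

lemma sets_lborel_subspace [measurable_cong]: "sets (lborel_subspace E) = sets borel"
  by (simp add: lborel_subspace_def)

lemma measurable_matrix_closest_point:
  assumes "sets \<nu> = sets (grassmannian_borel j)"
  shows "(\<lambda>E. matrix (closest_point E)) \<in> \<nu> \<rightarrow>\<^sub>M borel"
  unfolding measurable_cong_sets[OF assms refl] grassmannian_borel_def
  by (rule measurable_vimage_algebra1) simp

lemma space_grassmannian:
  assumes "sets \<nu> = sets (grassmannian_borel j)"
  shows "space \<nu> = grassmannian j"
  using sets_eq_imp_space_eq[OF assms] by (simp add: grassmannian_borel_def)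

lemma measurable_matrix_vector_mult:
  "(\<lambda>(P :: real ^ 'n ^ 'm, x). P *v x) \<in> borel \<Otimes>\<^sub>M borel \<rightarrow>\<^sub>M borel"
  unfolding borel_prod matrix_vector_mult_def case_prod_unfold
  by (intro borel_measurable_continuous_onI continuous_intros)

text \<open>The kernel \<open>a\<close> sees a subspace only through the matrix of its orthogonal projection, because
  the sigma-algebra of the Grassmannian is defined by these matrices.\<close>

lemma
  fixes a :: "real ^ 'n ^ 'n \<Rightarrow> real ^ 'n \<Rightarrow> real" and \<nu> :: "(real ^ 'n) set measure"
  assumes "prob_space \<nu>" and sets: "sets \<nu> = sets (grassmannian_borel j)"
    and meas: "(\<lambda>(P, x). a P x) \<in> borel_measurable (borel \<Otimes>\<^sub>M borel)"
    and m: "0 < m" "m \<le> 1"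
    and lower: "\<And>E y. E \<in> grassmannian j \<Longrightarrow> y \<in> E \<Longrightarrow> m * (norm y)\<^sup>2 - k \<le> a (matrix (closest_point E)) y"
  shows set_integrable_exp_kernel: "\<And>E. E \<in> grassmannian j \<Longrightarrow>
      set_integrable (lborel_subspace E) E (\<lambda>y. exp (- a (matrix (closest_point E)) y))" (is "\<And>E. _ \<Longrightarrow> ?A E")
    and integrable_exp_kernel:
      "integrable \<nu> (\<lambda>E. LINT y:E|lborel_subspace E. exp (- a (matrix (closest_point E)) y))" (is ?B)
proof -
  interpret prob_space \<nu> by fact
  note [measurable] = measurable_matrix_vector_mult meas
  define P where "P = (\<lambda>E :: (real ^ 'n) set. matrix (closest_point E))"
  have P [measurable]: "P \<in> \<nu> \<rightarrow>\<^sub>M borel"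
    unfolding P_def by (rule measurable_matrix_closest_point[OF sets])
  \<comment> \<open>\<open>Q\<close> ranges over all matrices, not only projections: the integrand
    is jointly Borel, which makes \<open>N\<close> Borel on the matrix space.\<close>
  define N where "N Q = (\<integral>\<^sup>+x. ennreal (exp (- a Q (Q *v x))) * ennreal (exp (- (norm (x - Q *v x))\<^sup>2)) \<partial>lborel)" for Q
  define C where "C = ennreal (sqrt pi) ^ (CARD('n) - j)"
  \<comment> \<open>The integral of exp (k - m |x|^2) over the whole space, a bound for
    \<open>N (P E)\<close> uniform in \<open>E\<close>.\<close>
  define K where "K = ennreal (exp k) * ennreal (sqrt (pi / m)) ^ CARD('n)"
  define J where "J E = (\<integral>\<^sup>+y. ennreal (exp (- a (P E) y)) \<partial>lborel_subspace E)" for E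
  have [measurable]: "N \<in> borel_measurable borel"
    unfolding N_def by measurable
  have C: "C \<noteq> 0" "C < top"
    by (auto simp: C_def ennreal_power)
  have K: "K < top"
    using m by (simp add: K_def ennreal_power ennreal_mult[symmetric])
  have meas': "a Q \<in> borel_measurable borel" for Q
    using measurable_Pair2[OF meas, of Q] by simp
  have NJ: "N (P E) = J E * C" and NK: "N (P E) \<le> K" if E: "E \<in> grassmannian j" for E
  proof -
    have sub: "subspace E" "dim E = j"
      using E by (auto simp: grassmannian_def)
    have PE: "P E *v x = closest_point E x" for x
      using sub by (simp add: P_def matrix_closest_point)
    show "N (P E) = J E * C"
      unfolding N_def PE J_def C_def sub(2)[symmetric] using meas'
      by (intro nn_integral_lborel_subspace sub) simp
    \<comment> \<open>Pythagoras splits m |x|^2 along \<open>E\<close> and its complement;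
      \<open>m \<le> 1\<close> lets the Gaussian weight absorb the complementary part.\<close>
    have "exp (- a (P E) (closest_point E x)) * exp (- (norm (x - closest_point E x))\<^sup>2)
        \<le> exp k * exp (- (m * (norm x)\<^sup>2))" for x
    proof -
      have "m * (norm (closest_point E x))\<^sup>2 - k \<le> a (P E) (closest_point E x)"
        unfolding P_def by (intro lower E closest_point_subspace sub)
      moreover have "m * (norm (x - closest_point E x))\<^sup>2 \<le> (norm (x - closest_point E x))\<^sup>2"
        using m by (intro mult_left_le_one_le) auto
      ultimately show ?thesis
        by (simp add: norm_closest_point_subspace[OF sub(1), of x] algebra_simps flip: exp_add)
    qed
    then have "N (P E) \<le> (\<integral>\<^sup>+x. ennreal (exp k) * ennreal (exp (- (m * (norm (x :: real ^ 'n))\<^sup>2))) \<partial>lborel)"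
      unfolding N_def PE by (intro nn_integral_mono) (simp flip: ennreal_mult)
    also have "\<dots> = K"
      using m by (simp add: nn_integral_cmult gaussian_nn_integral_euclidean K_def)
    finally show "N (P E) \<le> K" .
  qed
  \<comment> \<open>The constant \<open>C\<close> depends only on \<open>j\<close>, and it is
    nonzero and finite.\<close>
  have J: "J E = N (P E) / C" if "E \<in> grassmannian j" for E
    using C NJ[OF that] by (simp add: ennreal_mult_divide_eq)
  have int: "integrable (lborel_subspace E) (\<lambda>y. exp (- a (P E) y))" if E: "E \<in> grassmannian j" for E
  proof (rule integrableI_nonneg)
    have "N (P E) / C < top"
      using C K NK[OF E] by (auto simp: ennreal_divide_eq_top_iff less_top[symmetric] top_unique)
    then show "(\<integral>\<^sup>+y. ennreal (exp (- a (P E) y)) \<partial>lborel_subspace E) < \<infinity>"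
      using J[OF E] by (simp add: J_def)
  qed (use meas'[of "P E"] in auto)
  show "?A E" if E: "E \<in> grassmannian j" for E
    using int[OF E] E closed_subspace[of E] unfolding set_integrable_def P_def
    by (intro integrable_mult_indicator) (auto simp: sets_lborel_subspace grassmannian_def)
  have I: "(LINT y:E|lborel_subspace E. exp (- a (P E) y)) = enn2real (N (P E) / C)"
    if E: "E \<in> grassmannian j" for E
  proof -
    have sub: "subspace E"
      using E by (auto simp: grassmannian_def)
    note [measurable] = meas'[of "P E"]
    have [measurable]: "E \<in> sets borel"
      using closed_subspace[OF sub] by simp
    have "(LINT y:E|lborel_subspace E. exp (- a (P E) y)) = (LINT y|lborel_subspace E. exp (- a (P E) y))"
      unfolding set_lebesgue_integral_def
    proof (rule integral_cong_AE)
      show "AE y in lborel_subspace E. indicator E y *\<^sub>R exp (- a (P E) y) = exp (- a (P E) y)"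
        using AE_lborel_subspace[OF sub] by eventually_elim simp
    qed measurable
    also have "\<dots> = enn2real (J E)"
      unfolding J_def by (rule integral_eq_nn_integral) auto
    finally show ?thesis
      by (simp add: J E)
  qed
  \<comment> \<open>On the Grassmannian the inner integral is a Borel function of the projection
    matrix, hence measurable; with the uniform bound below, total mass 1 gives
    integrability.\<close>
  have "(\<lambda>E. LINT y:E|lborel_subspace E. exp (- a (P E) y)) \<in> borel_measurable \<nu>"
    by (subst measurable_cong[OF I]) (simp_all add: space_grassmannian[OF sets])
  moreover have "AE E in \<nu>. norm (LINT y:E|lborel_subspace E. exp (- a (P E) y)) \<le> enn2real (K / C)"
  proof (rule AE_I2)
    fix E assume "E \<in> space \<nu>"
    then have E: "E \<in> grassmannian j"
      by (simp add: space_grassmannian[OF sets])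
    have "N (P E) / C \<le> K / C"
      using NK[OF E] by (rule divide_right_mono_ennreal)
    moreover have "K / C < top"
      using C K by (auto simp: ennreal_divide_eq_top_iff less_top[symmetric])
    ultimately show "norm (LINT y:E|lborel_subspace E. exp (- a (P E) y)) \<le> enn2real (K / C)"
      using I[OF E] by (simp add: enn2real_mono)
  qed
  ultimately show ?B
    unfolding P_def by (intro integrable_const_bound)
qed

section \<open>Log-convexity of kernel integrals\<close>

lemma exp_convex_combination_powr:
  fixes a b h l :: real
  assumes "l * a + (1 - l) * b \<le> h"
  shows "exp (- h) \<le> exp (- a) powr l * exp (- b) powr (1 - l)"
  using assms by (simp add: powr_def algebra_simps flip: exp_add)

text \<open>Hoelder is used twice with the same exponents: on each \<open>E\<close> for the
  exponentials, then on the Grassmannian for the inner integrals. Kernels in a matrix and a point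
  cover both functionals, since restriction is a kernel ignoring the matrix.\<close>

lemma kernel_integral_log_convex:
  fixes a b h :: "real ^ 'n ^ 'n \<Rightarrow> real ^ 'n \<Rightarrow> real" and \<nu> :: "(real ^ 'n) set measure"
  assumes \<nu>: "prob_space \<nu>" "sets \<nu> = sets (grassmannian_borel j)"
    and a: "(\<lambda>(P, x). a P x) \<in> borel_measurable (borel \<Otimes>\<^sub>M borel)" "0 < ma" "ma \<le> 1"
      "\<And>E y. E \<in> grassmannian j \<Longrightarrow> y \<in> E \<Longrightarrow> ma * (norm y)\<^sup>2 - ka \<le> a (matrix (closest_point E)) y"
    and b: "(\<lambda>(P, x). b P x) \<in> borel_measurable (borel \<Otimes>\<^sub>M borel)" "0 < mb" "mb \<le> 1"
      "\<And>E y. E \<in> grassmannian j \<Longrightarrow> y \<in> E \<Longrightarrow> mb * (norm y)\<^sup>2 - kb \<le> b (matrix (closest_point E)) y"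
    and l: "0 < l" "l < 1"
    and h: "\<And>P y. l * a P y + (1 - l) * b P y \<le> h P y"
  defines "I \<equiv> \<lambda>c E. LINT y:E|lborel_subspace E. exp (- c (matrix (closest_point E)) y)"
  shows "(LINT E|\<nu>. I h E) \<le> (LINT E|\<nu>. I a E) powr l * (LINT E|\<nu>. I b E) powr (1 - l)"
proof (rule holder_integral_le)
  show "integrable \<nu> (I a)"
    unfolding I_def by (rule integrable_exp_kernel[OF \<nu> a])
  show "integrable \<nu> (I b)"
    unfolding I_def by (rule integrable_exp_kernel[OF \<nu> b])
  have "0 \<le> I c E" for c E
    unfolding I_def set_lebesgue_integral_def by (intro Bochner_Integration.integral_nonneg) auto
  then show "0 \<le> I a E" "0 \<le> I b E" for E
    by blast+
  show "I h E \<le> I a E powr l * I b E powr (1 - l)" if "E \<in> space \<nu>" for E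
    unfolding I_def set_lebesgue_integral_def
  proof (rule holder_integral_le)
    have E: "E \<in> grassmannian j"
      using that by (simp add: space_grassmannian[OF \<nu>(2)])
    show "integrable (lborel_subspace E) (\<lambda>y. indicator E y *\<^sub>R exp (- a (matrix (closest_point E)) y))"
      by (rule set_integrable_exp_kernel[OF \<nu> a E, unfolded set_integrable_def])
    show "integrable (lborel_subspace E) (\<lambda>y. indicator E y *\<^sub>R exp (- b (matrix (closest_point E)) y))"
      by (rule set_integrable_exp_kernel[OF \<nu> b E, unfolded set_integrable_def])
  qed (use l in \<open>auto simp: h exp_convex_combination_powr split: split_indicator\<close>)
qed (use l in auto)

section \<open>Quadratic lower bounds for positive homogeneous polynomials\<close>

lemma pos_hom_poly_continuous:
  assumes "f \<in> pos_hom_poly d"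
  shows "continuous_on S f"
  using assms by (simp add: pos_hom_poly_def real_polynomial_function_eq continuous_on_polymonial_function)

text \<open>Outside the unit ball, homogeneity and \<open>2 \<le> d\<close> bound \<open>f\<close>
  below by its minimum on the sphere times |x|^2; inside, subtracting 1 makes the bound nonpositive.
  The quadratic form allows comparison with a Gaussian for every \<open>d\<close>.\<close>

lemma pos_hom_poly_lower_bound:
  fixes f :: "real ^ 'n \<Rightarrow> real"
  assumes f: "f \<in> pos_hom_poly d" and d: "2 \<le> d"
  obtains m where "0 < m" "m \<le> 1" "\<And>x. m * (norm x)\<^sup>2 - 1 \<le> f x" "\<And>x. 0 \<le> f x"
proof -
  have hom: "f (c *\<^sub>R x) = c ^ d * f x" if "c > 0" for c x
    using f that by (auto simp: pos_hom_poly_def)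
  have pos: "f x > 0" if "x \<noteq> 0" for x
    using f that by (auto simp: pos_hom_poly_def)
  have "(1 :: real) < 2 ^ d"
    using d by (intro one_less_power) auto
  moreover have "f 0 = 2 ^ d * f 0"
    using hom[of 2 0] by simp
  ultimately have f0: "f 0 = 0"
    by simp
  have "sphere (0 :: real ^ 'n) 1 \<noteq> {}"
    by simp
  from continuous_attains_inf[OF compact_sphere this pos_hom_poly_continuous[OF f]]
  obtain x0 where x0: "norm x0 = 1" "\<And>x. norm x = 1 \<Longrightarrow> f x0 \<le> f x"
    by (auto simp: dist_norm)
  \<comment> \<open>The cap at 1 serves the bound inside the unit ball and the absorption into the
    complementary Gaussian.\<close>
  define m where "m = min (f x0) 1"
  have "f x0 > 0"
    using x0 pos[of x0] by fastforce
  then have m: "0 < m" "m \<le> 1" "m \<le> f x0"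
    by (auto simp: m_def)
  have nonneg: "0 \<le> f x" for x
    using f0 pos[of x] by (cases "x = 0") auto
  have "m * (norm x)\<^sup>2 - 1 \<le> f x" for x
  proof (cases "norm x \<le> 1")
    case True
    then have "m * (norm x)\<^sup>2 \<le> 1"
      using m by (intro mult_le_one) (auto simp: power_le_one)
    then show ?thesis
      using nonneg[of x] by simp
  next
    case False
    then have "x \<noteq> 0" "(norm x)\<^sup>2 \<le> norm x ^ d"
      using d by (auto intro: power_increasing)
    moreover have "f x = norm x ^ d * f (x /\<^sub>R norm x)"
      using hom[of "norm x" "x /\<^sub>R norm x"] \<open>x \<noteq> 0\<close> by simp
    moreover have "m \<le> f (x /\<^sub>R norm x)"
      using m(3) x0(2)[of "x /\<^sub>R norm x"] \<open>x \<noteq> 0\<close> by simp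
    ultimately have "(norm x)\<^sup>2 * m \<le> f x"
      using m by (auto intro: mult_mono)
    then show ?thesis
      by (simp add: mult.commute)
  qed
  then show ?thesis
    using that m nonneg by blast
qed

section \<open>Projection of a function as a kernel in the projection matrix\<close>

text \<open>For the projection \<open>P\<close> onto \<open>E\<close>, the vector \<open>z - P *v z\<close> ranges over \<open>E\<^sup>\<bottom>\<close>.\<close>

definition proj_kernel :: "(real ^ 'n \<Rightarrow> real) \<Rightarrow> real ^ 'n ^ 'n \<Rightarrow> real ^ 'n \<Rightarrow> real" where
  "proj_kernel f P y = (INF z. f (y + (z - P *v z)))"

lemma proj_fun_eq_proj_kernel:
  assumes E: "subspace E" and y: "y \<in> E"
  shows "proj_fun E f y = proj_kernel f (matrix (closest_point E)) y"
proof -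
  have "closest_point E z = 0" if "z \<in> E\<^sup>\<bottom>" for z
    using that by (intro closest_point_subspace_eqI) (auto simp: E subspace_0)
  then have "E\<^sup>\<bottom> = range (\<lambda>z. z - closest_point E z)"
    using closest_point_subspace(2)[OF E] by (auto simp: image_iff) (metis diff_zero)
  then show ?thesis
    using y by (simp add: proj_fun_def proj_kernel_def matrix_closest_point E image_image)
qed

text \<open>An infimum lies below \<open>t\<close> exactly when some member does, so the sublevel
  set is a union of open sets; openness makes the uncountable union harmless.\<close>

lemma proj_kernel_measurable:
  fixes f :: "real ^ 'n \<Rightarrow> real"
  assumes cont: "continuous_on UNIV f" and nonneg: "\<And>x. 0 \<le> f x"
  shows "(\<lambda>(P, x). proj_kernel f P x) \<in> borel_measurable (borel \<Otimes>\<^sub>M borel)"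
  unfolding borel_prod
proof (rule borel_measurableI_less)
  fix t :: real
  have "bdd_below (range (\<lambda>z. f (y + (z - P *v z))))" for y P
    using nonneg by (intro bdd_belowI[of _ 0]) auto
  then have "{p. (\<lambda>(P, x). proj_kernel f P x) p < t} = (\<Union>z. {p. f (snd p + (z - fst p *v z)) < t})"
    by (auto simp: proj_kernel_def cINF_less_iff)
  moreover have "open {p. f (snd p + (z - fst p *v z)) < t}" for z
    unfolding matrix_vector_mult_def
    by (intro open_Collect_less continuous_on_compose2[OF cont] continuous_intros) auto
  ultimately show "{p \<in> space borel. (\<lambda>(P, x). proj_kernel f P x) p < t} \<in> sets borel"
    by (simp add: open_UN)
qed

text \<open>Adding a vector orthogonal to \<open>y\<close> cannot shorten it, so the bound on
  \<open>f\<close> passes to the infimum with the same constants.\<close>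

lemma proj_kernel_lower_bound:
  assumes E: "subspace E" and y: "y \<in> E" and m: "0 < m"
    and f: "\<And>x. m * (norm x)\<^sup>2 - k \<le> f x"
  shows "m * (norm y)\<^sup>2 - k \<le> proj_kernel f (matrix (closest_point E)) y"
  unfolding proj_kernel_def
proof (rule cINF_greatest)
  fix z
  have "orthogonal y (z - closest_point E z)"
    using closest_point_subspace(2)[OF E, of z] y by (auto simp: orthogonal_comp_def)
  from norm_add_Pythagorean[OF this] have "m * (norm y)\<^sup>2 \<le> m * (norm (y + (z - closest_point E z)))\<^sup>2"
    using m by simp
  then show "m * (norm y)\<^sup>2 - k \<le> f (y + (z - matrix (closest_point E) *v z))"
    using f[of "y + (z - closest_point E z)"] by (simp add: matrix_closest_point E)
qed simp

text \<open>In the combined infimum one \<open>z\<close> must serve both summands, whereas separate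
  infima choose independently.\<close>

lemma proj_kernel_superadditive:
  assumes "\<And>x. 0 \<le> f x" "\<And>x. 0 \<le> g x" "0 < l" "l < (1 :: real)"
  shows "l * proj_kernel f P y + (1 - l) * proj_kernel g P y \<le> proj_kernel (\<lambda>x. l * f x + (1 - l) * g x) P y"
  unfolding proj_kernel_def
proof (rule cINF_greatest)
  fix z
  have "(INF z. f (y + (z - P *v z))) \<le> f (y + (z - P *v z))"
    and "(INF z. g (y + (z - P *v z))) \<le> g (y + (z - P *v z))"
    using assms by (auto intro!: cINF_lower bdd_belowI[of _ 0])
  then show "l * (INF z. f (y + (z - P *v z))) + (1 - l) * (INF z. g (y + (z - P *v z)))
      \<le> l * f (y + (z - P *v z)) + (1 - l) * g (y + (z - P *v z))"
    using assms by (intro add_mono mult_left_mono) auto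
qed simp

section \<open>Normalising constants and conclusion\<close>

text \<open>The exponents add up to 1, so a nonnegative constant distributes over the two
  factors.\<close>

lemma mult_powr_convex_combination:
  fixes c u v x :: real
  assumes "0 \<le> c" "0 \<le> u" "0 \<le> v" "x \<le> u powr l * v powr (1 - l)"
  shows "c * x \<le> (c * u) powr l * (c * v) powr (1 - l)"
proof -
  have "c * x \<le> c * (u powr l * v powr (1 - l))"
    using assms by (intro mult_left_mono) auto
  also have "\<dots> = (c powr l * c powr (1 - l)) * (u powr l * v powr (1 - l))"
    using assms by (simp flip: powr_add)
  also have "\<dots> = (c * u) powr l * (c * v) powr (1 - l)"
    using assms by (simp add: powr_mult mult_ac)
  finally show ?thesis .
qed

lemma integrable_exp_lower_bound:
  fixes f :: "'a::euclidean_space \<Rightarrow> real"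
  assumes "continuous_on UNIV f" "0 < m" "\<And>x. m * (norm x)\<^sup>2 - k \<le> f x"
  shows "integrable lborel (\<lambda>x. exp (- f x))"
proof (rule integrableI_nonneg)
  have "(\<integral>\<^sup>+x. ennreal (exp (- f x)) \<partial>lborel) \<le> (\<integral>\<^sup>+x. ennreal (exp k) * ennreal (exp (- (m * (norm (x :: 'a))\<^sup>2))) \<partial>lborel)"
    using assms(3) by (intro nn_integral_mono) (simp add: algebra_simps flip: ennreal_mult exp_add)
  also have "\<dots> = ennreal (exp k) * ennreal (sqrt (pi / m)) ^ DIM('a)"
    using assms by (simp add: nn_integral_cmult gaussian_nn_integral_euclidean)
  also have "\<dots> < \<infinity>"
    using assms by (simp add: ennreal_power ennreal_mult[symmetric])
  finally show "(\<integral>\<^sup>+x. ennreal (exp (- f x)) \<partial>lborel) < \<infinity>" .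
qed (use assms in \<open>auto intro!: borel_measurable_continuous_onI continuous_intros\<close>)

theorem corollary4p1:
  fixes f g :: "real ^ 'n \<Rightarrow> real"
    and j d :: nat
    and l :: real
    and \<nu> :: "(real ^ 'n) set measure"
  assumes "2 \<le> CARD('n)"
    and "2 \<le> d" and "even d"
    and "1 \<le> j" and "j \<le> CARD('n)"
    and "j < CARD('n) \<Longrightarrow> haar_grassmannian j \<nu>"
    and "f \<in> pos_hom_poly d" and "g \<in> pos_hom_poly d"
    and "0 < l" and "l < 1"
  shows "V_proj \<nu> d j (\<lambda>x. l * f x + (1 - l) * g x)
           \<le> V_proj \<nu> d j f powr l * V_proj \<nu> d j g powr (1 - l) \<and>
         V_restr \<nu> d j (\<lambda>x. l * f x + (1 - l) * g x)
           \<le> V_restr \<nu> d j f powr l * V_restr \<nu> d j g powr (1 - l)"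
proof -
  let ?h = "\<lambda>x. l * f x + (1 - l) * g x"
  note l = \<open>0 < l\<close> \<open>l < 1\<close>
  note cf = pos_hom_poly_continuous[OF \<open>f \<in> pos_hom_poly d\<close>, of UNIV]
    and cg = pos_hom_poly_continuous[OF \<open>g \<in> pos_hom_poly d\<close>, of UNIV]
  obtain mf where mf: "0 < mf" "mf \<le> 1" "\<And>x. mf * (norm x)\<^sup>2 - 1 \<le> f x" "\<And>x. 0 \<le> f x"
    using pos_hom_poly_lower_bound[OF \<open>f \<in> pos_hom_poly d\<close> \<open>2 \<le> d\<close>] by blast
  obtain mg where mg: "0 < mg" "mg \<le> 1" "\<And>x. mg * (norm x)\<^sup>2 - 1 \<le> g x" "\<And>x. 0 \<le> g x"
    using pos_hom_poly_lower_bound[OF \<open>g \<in> pos_hom_poly d\<close> \<open>2 \<le> d\<close>] by blast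
  have Gamma: "0 < Gamma (1 + real i / real d)" for i
    by (intro Gamma_real_pos) (simp add: add_pos_nonneg)
  show ?thesis
  proof (cases "j = CARD('n)")
    case True
    \<comment> \<open>In top dimension both functionals are \<open>V_top\<close>, and one use of
      Hoelder on the whole space settles both claims.\<close>
    have "(LINT x|lborel. exp (- ?h x))
        \<le> (LINT x|lborel. exp (- f x)) powr l * (LINT x|lborel. exp (- g x)) powr (1 - l)"
      using l integrable_exp_lower_bound[OF cf mf(1,3)] integrable_exp_lower_bound[OF cg mg(1,3)]
      by (intro holder_integral_le exp_convex_combination_powr) auto
    then have "V_top d ?h \<le> V_top d f powr l * V_top d g powr (1 - l)"
      unfolding V_top_def using Gamma[of "CARD('n)"]
      by (intro mult_powr_convex_combination) (auto simp: less_imp_le)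
    then show ?thesis
      using True by (simp add: V_proj_def V_restr_def)
  next
    case False
    then have \<nu>: "prob_space \<nu>" "sets \<nu> = sets (grassmannian_borel j)"
      using assms by (auto simp: haar_grassmannian_def)
    note space = space_grassmannian[OF \<nu>(2)]
    have sub: "subspace E" if "E \<in> grassmannian j" for E :: "(real ^ 'n) set"
      using that by (simp add: grassmannian_def)
    let ?I = "\<lambda>k. LINT E|\<nu>. (LINT y:E|lborel_subspace E. exp (- k (matrix (closest_point E)) y :: real))"
    have nonneg: "0 \<le> ?I k" for k
      unfolding set_lebesgue_integral_def by (intro Bochner_Integration.integral_nonneg) auto
    have lower: "mf * (norm y)\<^sup>2 - 1 \<le> proj_kernel f (matrix (closest_point E)) y"
      "mg * (norm y)\<^sup>2 - 1 \<le> proj_kernel g (matrix (closest_point E)) y"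
      if "E \<in> grassmannian j" "y \<in> E" for E y
      using mf mg sub that by (auto intro: proj_kernel_lower_bound)
    have proj: "?I (proj_kernel ?h) \<le> ?I (proj_kernel f) powr l * ?I (proj_kernel g) powr (1 - l)"
      by (rule kernel_integral_log_convex[OF \<nu> proj_kernel_measurable[OF cf mf(4)] mf(1,2) lower(1)
            proj_kernel_measurable[OF cg mg(4)] mg(1,2) lower(2) l])
        (use mf mg l in \<open>auto intro: proj_kernel_superadditive\<close>)
    have "(\<lambda>(P, x). f x) \<in> borel_measurable (borel \<Otimes>\<^sub>M borel)"
      "(\<lambda>(P, x). g x) \<in> borel_measurable (borel \<Otimes>\<^sub>M borel)"
      using borel_measurable_continuous_onI[OF cf] borel_measurable_continuous_onI[OF cg]
      by (simp_all add: case_prod_unfold)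
    \<comment> \<open>For restriction the convexity condition on the kernels holds with
      equality.\<close>
    then have restr: "?I (\<lambda>_. ?h) \<le> ?I (\<lambda>_. f) powr l * ?I (\<lambda>_. g) powr (1 - l)"
      by (rule kernel_integral_log_convex[OF \<nu> _ mf(1,2,3) _ mg(1,2,3) l]) auto
    \<comment> \<open>The indicator of \<open>E\<close> discards the points where
      \<open>proj_fun\<close> is undefined and need not agree with the kernel.\<close>
    have V_proj: "V_proj \<nu> d j k = beta_coeff j CARD('n) / Gamma (1 + real j / real d) * ?I (proj_kernel k)" for k
    proof -
      have "(LINT E|\<nu>. (LINT y:E|lborel_subspace E. exp (- proj_fun E k y))) = ?I (proj_kernel k)"
        unfolding set_lebesgue_integral_def
        by (intro Bochner_Integration.integral_cong refl)
          (auto simp: space sub proj_fun_eq_proj_kernel split: split_indicator)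
      then show ?thesis
        using False by (simp add: V_proj_def)
    qed
    have V_restr: "V_restr \<nu> d j k = sigma_coeff j CARD('n) / Gamma (1 + real j / real d) * ?I (\<lambda>_. k)" for k
    proof -
      have "(LINT E|\<nu>. (LINT y:E|lborel_subspace E. exp (- restr_fun E k y))) = ?I (\<lambda>_. k)"
        unfolding set_lebesgue_integral_def
        by (intro Bochner_Integration.integral_cong refl)
          (auto simp: restr_fun_def split: split_indicator)
      then show ?thesis
        using False by (simp add: V_restr_def)
    qed
    have "0 \<le> beta_coeff j CARD('n) / Gamma (1 + real j / real d)"
      "0 \<le> sigma_coeff j CARD('n) / Gamma (1 + real j / real d)"
      using Gamma[of j] by (auto simp: beta_coeff_def sigma_coeff_def less_imp_le)
    then show ?thesis
      unfolding V_proj V_restr using proj restr nonneg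
      by (intro conjI mult_powr_convex_combination)
  qed
qed

end
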